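(* Let $G=(V\cup\mathcal{H},D)$ be a factor analysis graph. Let $\mathcal{A}=(A_h)_{h\in\mathcal{H}}$ be a valid collection of $2$-pairs such that the sum of cardinalities $\sum_{h\in\mathcal{H}}|A_h|$ is maximal among all valid collections. Then $$\dim(F(G))\le |V|+\sum_{h\in\mathcal{H}}|A_h|.$$
   Context: A factor analysis graph is a directed graph $G=(V\cup\mathcal{H},D)$ where $V$ (observed nodes) and $\mathcal{H}$ (latent nodes) are finite disjoint sets and $D\subseteq\mathcal{H}\times V$; an element $(h,v)\in D$ is an edge $h\to v$. Write $\mathrm{pa}(v)=\{h\in\mathcal{H}: (h,v)\in D\}$ for $v\in V$ and $\mathrm{ch}(h)=\{v\in V:(h,v)\in D\}$ for $h\in\mathcal{H}$. Let $p=|V|$. Let $\mathbb{R}^D$ be the set of real $|V|\times|\mathcal{H}|$ matrices $\Lambda=(\lambda_{vh})$ with $\lambda_{vh}=0$ whenever $(h,v)\notin D$, let $\mathbb{R}^p_{>0}$ be the set of diagonal $p\times p$ matrices with positive diagonal entries, and let $\mathrm{PD}(p)$ be the cone of positive definite symmetric $p\times p$ matrices. The factor analysis model $F(G)$ is the image of the map $\tau_G:\mathbb{R}^p_{>0}\times\mathbb{R}^D\to\mathrm{PD}(p)$, $(\Omega,\Lambda)\mapsto\Omega+\Lambda\Lambda^\top$. Its dimension $\dim(F(G))$ is the maximal rank of the Jacobian matrix of $\tau_G$ (as a map into the $\binom{p+1}{2}$-dimensional space of symmetric matrices). Let $C(V,2)$ be the set of all two-element subsets $\{u,v\}$ of $V$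 (the $2$-pairs). For $h\in\mathcal{H}$ let $C(V,2)_h=\{\{u,v\}\in C(V,2): h\in\mathrm{pa}(u)\cap\mathrm{pa}(v)\}$. A collection $\mathcal{A}=(A_h)_{h\in\mathcal{H}}$ with $A_h\subseteq C(V,2)$ is valid if (i) $A_h\subseteq C(V,2)_h$ and $|A_h|\le|\mathrm{ch}(h)|$ for all $h\in\mathcal{H}$, and (ii) $A_h\cap A_\ell=\emptyset$ for all $h\neq\ell$. *)

theory Defs
  imports "HOL-Analysis.Analysis" "HOL-Library.Function_Algebras"
begin

locale factor_analysis_graph =
  fixes V H :: "'a set" and D :: "('a \<times> 'a) set"
  assumes finite_observed: "finite V"
    and finite_latent: "finite H"
    and disjoint_nodes: "V \<inter> H = {}"
    and edges_latent_to_observed: "D \<subseteq> H \<times> V"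

definition pa :: "'a set \<Rightarrow> ('a \<times> 'a) set \<Rightarrow> 'a \<Rightarrow> 'a set" where
  "pa H D v = {h \<in> H. (h, v) \<in> D}"

definition ch :: "'a set \<Rightarrow> ('a \<times> 'a) set \<Rightarrow> 'a \<Rightarrow> 'a set" where
  "ch V D h = {v \<in> V. (h, v) \<in> D}"

text \<open>
  A matrix with rows indexed by a set \<open>R\<close> and columns indexed by a set \<open>C\<close> is a curried function
  on the ambient types. Its rank is the dimension of its column space, where the columns are cut
  off to \<open>0\<close> outside \<open>R\<close> and live in the function space with pointwise operations
  (addition from \<open>Function_Algebras\<close>).
\<close>
definition matrix_rank :: "'r set \<Rightarrow> 'c set \<Rightarrow> ('r \<Rightarrow> 'c \<Rightarrow> real) \<Rightarrow> nat" where
  "matrix_rank R C M =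
     vector_space.dim (\<lambda>(c::real) f x. c * f x) ((\<lambda>j i. if i \<in> R then M i j else 0) ` C)"

text \<open>
  The parameters are the diagonal \<open>\<omega>\<close> of \<open>\<Omega>\<close> and the loading matrix \<open>\<Lambda>\<close>, with rows indexed by
  observed and columns by latent nodes.
\<close>
definition parameter_space ::
    "'a set \<Rightarrow> ('a \<times> 'a) set \<Rightarrow> (('a \<Rightarrow> real) \<times> ('a \<Rightarrow> 'a \<Rightarrow> real)) set" where
  "parameter_space V D =
     {(\<omega>, \<Lambda>). (\<forall>v\<in>V. \<omega> v > 0) \<and> (\<forall>v. v \<notin> V \<longrightarrow> \<omega> v = 0) \<and>
              (\<forall>v h. (h, v) \<notin> D \<longrightarrow> \<Lambda> v h = 0)}"

text \<open>The \<open>(u, w)\<close> entry of \<open>\<Omega> + \<Lambda> \<Lambda>\<^sup>T\<close>, meant for observed \<open>u\<close> and \<open>w\<close>.\<close>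
definition tau ::
    "'a set \<Rightarrow> ('a \<Rightarrow> real) \<Rightarrow> ('a \<Rightarrow> 'a \<Rightarrow> real) \<Rightarrow> 'a \<Rightarrow> 'a \<Rightarrow> real" where
  "tau H \<omega> \<Lambda> u w = (if u = w then \<omega> u else 0) + (\<Sum>h\<in>H. \<Lambda> u h * \<Lambda> w h)"

lemma tau_sym: "tau H \<omega> \<Lambda> u w = tau H \<omega> \<Lambda> w u"
  by (simp add: tau_def mult.commute)

text \<open>
  Coordinates of the parameter space: \<open>Inl v\<close> stands for \<open>\<omega>\<^sub>v\<close> and \<open>Inr (h, v)\<close> for \<open>\<lambda>\<^sub>v\<^sub>h\<close>.
\<close>
definition parameter_indices :: "'a set \<Rightarrow> ('a \<times> 'a) set \<Rightarrow> ('a + 'a \<times> 'a) set" where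
  "parameter_indices V D = V <+> D"

text \<open>
  The partial derivative of the \<open>(u, w)\<close> entry of \<open>\<tau>\<close> with respect to one coordinate, all the
  others being held fixed. (\<open>fun_upd\<close> is spelled out because \<open>\<omega>(_)\<close> is Landau notation.)
\<close>
fun tau_jacobian ::
    "'a set \<Rightarrow> ('a \<Rightarrow> real) \<Rightarrow> ('a \<Rightarrow> 'a \<Rightarrow> real) \<Rightarrow> 'a \<times> 'a \<Rightarrow> 'a + 'a \<times> 'a \<Rightarrow> real" where
  "tau_jacobian H \<omega> \<Lambda> (u, w) (Inl v) = deriv (\<lambda>t. tau H (fun_upd \<omega> v t) \<Lambda> u w) (\<omega> v)"
| "tau_jacobian H \<omega> \<Lambda> (u, w) (Inr (h, v)) =
     deriv (\<lambda>t. tau H \<omega> (\<Lambda>(v := (\<Lambda> v)(h := t))) u w) (\<Lambda> v h)"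

lemma tau_jacobian_sym: "tau_jacobian H \<omega> \<Lambda> (u, w) k = tau_jacobian H \<omega> \<Lambda> (w, u) k"
  by (cases k) (auto simp: tau_sym[of _ _ _ u w])

text \<open>
  The dimension of the factor analysis model. Every column of the Jacobian is a symmetric
  \<open>V \<times> V\<close> matrix (lemma \<open>tau_jacobian_sym\<close>), that is, an element of the space of symmetric
  matrices in which \<open>\<tau>\<close> takes its values. Listing both entries \<open>(u, w)\<close> and \<open>(w, u)\<close> only repeats rows and so
  leaves the rank unchanged. The maximum exists by lemmas \<open>jacobian_ranks_finite\<close> and
  \<open>parameter_space_nonempty\<close> below.
\<close>
definition dim_factor_analysis_model :: "'a set \<Rightarrow> 'a set \<Rightarrow> ('a \<times> 'a) set \<Rightarrow> nat" where
  "dim_factor_analysis_model V H D =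
     Max ((\<lambda>(\<omega>, \<Lambda>). matrix_rank (V \<times> V) (parameter_indices V D) (tau_jacobian H \<omega> \<Lambda>))
            ` parameter_space V D)"

lemma vector_space_fun: "vector_space (\<lambda>(c::real) (f :: 'r \<Rightarrow> real) x. c * f x)"
  by unfold_locales (auto simp: fun_eq_iff algebra_simps)

lemma matrix_rank_le_card:
  fixes M :: "'r \<Rightarrow> 'c \<Rightarrow> real"
  assumes "finite C"
  shows "matrix_rank R C M \<le> card C"
proof -
  interpret f: vector_space "\<lambda>(c::real) (f :: 'r \<Rightarrow> real) x. c * f x"
    by (rule vector_space_fun)
  show ?thesis
    unfolding matrix_rank_def
    by (rule order_trans[OF f.dim_le_card' card_image_le]) (use assms in auto)
qed

context factor_analysis_graph
begin

lemma jacobian_ranks_finite: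
  "finite ((\<lambda>(\<omega>, \<Lambda>). matrix_rank (V \<times> V) (parameter_indices V D) (tau_jacobian H \<omega> \<Lambda>))
            ` parameter_space V D)"
proof -
  have "finite D"
    using finite_subset[OF edges_latent_to_observed] finite_latent finite_observed by simp
  then have "finite (parameter_indices V D)"
    by (simp add: parameter_indices_def finite_observed)
  note le = matrix_rank_le_card[OF this]
  show ?thesis
    by (rule finite_subset[OF _ finite_atMost[of "card (parameter_indices V D)"]])
       (auto intro: le)
qed

lemma parameter_space_nonempty: "parameter_space V D \<noteq> {}"
proof -
  have "(\<lambda>v. if v \<in> V then 1 else 0, \<lambda>_ _. 0) \<in> parameter_space V D"
    by (simp add: parameter_space_def)
  then show ?thesis by blast
qed

end

definition two_pairs :: "'a set \<Rightarrow> 'a set set" where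
  "two_pairs V = {{u, v} | u v. u \<in> V \<and> v \<in> V \<and> u \<noteq> v}"

definition two_pairs_at :: "'a set \<Rightarrow> 'a set \<Rightarrow> ('a \<times> 'a) set \<Rightarrow> 'a \<Rightarrow> 'a set set" where
  "two_pairs_at V H D h =
     {{u, v} | u v. {u, v} \<in> two_pairs V \<and> h \<in> pa H D u \<inter> pa H D v}"

definition valid_collection ::
    "'a set \<Rightarrow> 'a set \<Rightarrow> ('a \<times> 'a) set \<Rightarrow> ('a \<Rightarrow> 'a set set) \<Rightarrow> bool" where
  "valid_collection V H D A \<longleftrightarrow>
     (\<forall>h\<in>H. A h \<subseteq> two_pairs_at V H D h \<and> card (A h) \<le> card (ch V D h)) \<and>
     (\<forall>h\<in>H. \<forall>l\<in>H. h \<noteq> l \<longrightarrow> A h \<inter> A l = {})"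

end

theory Submission
  imports Defs
begin

text \<open>
  Modulo the span of the derivatives in the diagonal directions \<open>\<omega>\<^sub>v\<close>, the Jacobian column of
  \<open>\<lambda>\<^sub>v\<^sub>h\<close> is a combination of the symmetric matrix units belonging to the pairs \<open>{v, w}\<close> with
  \<open>v, w \<in> ch(h)\<close>. By exchange, independent columns can be matched injectively with matrix
  units occurring in them. Collecting the pairs matched with the columns of each \<open>h\<close> gives a valid
  collection, because \<open>h\<close> has only \<open>|ch(h)|\<close> columns.
\<close>

text \<open>Exchange by induction on \<open>S\<close>, with \<open>T\<close> free to grow. Since
  \<open>x\<close> lies in \<open>span (N x)\<close> but not in \<open>span (S \<union> T)\<close>,
  some \<open>e\<close> in \<open>N x\<close> escapes \<open>span (S \<union> T)\<close>, and
  \<open>e\<close> joins \<open>T\<close> in place of \<open>x\<close>. The values taken on the rest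
  of \<open>S\<close> avoid \<open>span (insert e T)\<close>, so they differ from \<open>e\<close>;
  this makes the map injective.\<close>

lemma (in vector_space) independent_imp_matching:
  assumes "finite S" "independent (S \<union> T)" "S \<inter> T = {}" "\<And>x. x \<in> S \<Longrightarrow> x \<in> span (N x)"
  shows "\<exists>\<phi>. inj_on \<phi> S \<and> (\<forall>x\<in>S. \<phi> x \<in> N x - span T)"
  using assms
proof (induction S arbitrary: T rule: finite_induct)
  case (insert x S)
  have x: "x \<notin> span (S \<union> T)"
    using insert.prems insert.hyps by (auto simp: independent_insert)
  have "\<not> N x \<subseteq> span (S \<union> T)"
    using x insert.prems(3)[of x] span_minimal[OF _ subspace_span] by blast
  then obtain e where e: "e \<in> N x" "e \<notin> span (S \<union> T)" by blast
  have "independent (S \<union> T)"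
    by (rule independent_mono[OF insert.prems(1)]) auto
  then have "independent (S \<union> insert e T)"
    using e by (simp add: independent_insert)
  moreover have "S \<inter> insert e T = {}"
    using e insert.prems(2) span_base[of e "S \<union> T"] by auto
  ultimately obtain \<phi> where \<phi>: "inj_on \<phi> S" "\<forall>y\<in>S. \<phi> y \<in> N y - span (insert e T)"
    using insert.IH[of "insert e T"] insert.prems(3) by auto
  have "e \<notin> \<phi> ` S"
    using \<phi>(2) span_base[of e "insert e T"] by auto
  then have "inj_on (\<phi>(x := e)) (insert x S)"
    using \<phi>(1) insert.hyps by (auto simp: inj_on_def)
  moreover have "e \<notin> span T"
    using e span_mono[of T "S \<union> T"] by auto
  moreover have "span T \<subseteq> span (insert e T)"
    by (rule span_mono) auto
  ultimately show ?case
    using \<phi>(2) e(1) insert.hyps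
    by (intro exI[of _ "\<phi>(x := e)"] conjI) (auto simp del: fun_upd_apply simp: fun_upd_def)
qed simp

text \<open>Indexing by the set of the two positions treats both kinds of unit at once: a pair gives
  a symmetric off-diagonal unit, and \<open>{v, v} = {v}\<close> gives a diagonal one.\<close>

definition sym_unit :: "'a set \<Rightarrow> 'a \<times> 'a \<Rightarrow> real" where
  "sym_unit p = (\<lambda>(u, w). if {u, w} = p then 1 else 0)"

lemma tau_jacobian_diagonal:
  "tau_jacobian H \<omega> \<Lambda> (u, w) (Inl v) = sym_unit {v} (u, w)"
proof -
  have "((\<lambda>t. tau H (fun_upd \<omega> v t) \<Lambda> u w) has_field_derivative sym_unit {v} (u, w)) (at (\<omega> v))"
    unfolding tau_def sym_unit_def
    by (cases "u = w"; cases "u = v") (auto intro!: derivative_eq_intros)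
  then show ?thesis by (simp add: DERIV_imp_deriv)
qed

lemma tau_jacobian_loading:
  assumes "finite H" "h \<in> H"
  shows "tau_jacobian H \<omega> \<Lambda> (u, w) (Inr (h, v)) =
    (if u = v then \<Lambda> w h else 0) + (if w = v then \<Lambda> u h else 0)"
proof -
  have entry: "((\<lambda>t. (\<Lambda>(v := (\<Lambda> v)(h := t))) a l) has_field_derivative
      (if a = v \<and> l = h then 1 else 0)) (at (\<Lambda> v h))" for a l
    by (cases "a = v"; cases "l = h") (auto intro!: derivative_eq_intros)
  have "((\<lambda>t. tau H \<omega> (\<Lambda>(v := (\<Lambda> v)(h := t))) u w) has_field_derivative
      0 + (\<Sum>l\<in>H. (if u = v \<and> l = h then 1 else 0) * \<Lambda> w l
        + (if w = v \<and> l = h then 1 else 0) * \<Lambda> u l)) (at (\<Lambda> v h))"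
    unfolding tau_def
    by (intro DERIV_add DERIV_const DERIV_sum DERIV_cong[OF DERIV_mult[OF entry entry]])
       (auto simp: algebra_simps)
  moreover have "(\<Sum>l\<in>H. (if u = v \<and> l = h then 1 else 0) * \<Lambda> w l
        + (if w = v \<and> l = h then 1 else 0) * \<Lambda> u l) =
      (\<Sum>l\<in>H. if l = h then (if u = v then \<Lambda> w h else 0) + (if w = v then \<Lambda> u h else 0) else 0)"
    by (intro sum.cong) auto
  ultimately show ?thesis using assms by (simp add: DERIV_imp_deriv)
qed

context factor_analysis_graph
begin

lemma finite_edges: "finite D"
  using finite_subset[OF edges_latent_to_observed] finite_latent finite_observed by simp

lemma finite_ch: "finite (ch V D h)"
  using finite_observed by (simp add: ch_def)

text \<open>The column lives on row and column \<open>v\<close>, where its entries are multiples of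
  \<open>\<Lambda> y h\<close>; these vanish unless \<open>y\<close> is a child of \<open>h\<close>.
  The diagonal unit (\<open>y = v\<close>) is among the generators.\<close>

lemma tau_jacobian_loading_in_span:
  assumes hv: "(h, v) \<in> D" and \<Lambda>: "(\<omega>, \<Lambda>) \<in> parameter_space V D"
  shows "(\<lambda>i. if i \<in> V \<times> V then tau_jacobian H \<omega> \<Lambda> i (Inr (h, v)) else 0)
    \<in> module.span (\<lambda>(c::real) f x. c * f x) ((\<lambda>y. sym_unit {v, y}) ` ch V D h)"
    (is "?c \<in> _")
proof -
  interpret f: vector_space "\<lambda>(c::real) (f :: 'a \<times> 'a \<Rightarrow> real) x. c * f x"
    by (rule vector_space_fun)
  have h: "h \<in> H" and v: "v \<in> V" using hv edges_latent_to_observed by auto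
  have zero: "\<Lambda> y h = 0" if "y \<notin> ch V D h" for y
    using that \<Lambda> subsetD[OF edges_latent_to_observed, of "(h, y)"]
    by (auto simp: parameter_space_def ch_def)
  have chV: "ch V D h \<subseteq> V" by (auto simp: ch_def)
  \<comment> \<open>The factor 2 at \<open>y = v\<close> comes from differentiating the square of
    \<open>\<Lambda> v h\<close> in the diagonal entry.\<close>
  let ?a = "\<lambda>y. \<Lambda> y h * (if y = v then 2 else 1)"
  have sum_apply: "(\<Sum>y\<in>Y. g y) i = (\<Sum>y\<in>Y. g y i)"
    for g :: "'a \<Rightarrow> 'a \<times> 'a \<Rightarrow> real" and Y i
    by (induction Y rule: infinite_finite_induct) auto
  \<comment> \<open>If \<open>z\<close> is not a child of \<open>h\<close>, both sides are 0 by
    \<open>zero\<close>.\<close>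
  have pick: "(\<Sum>y\<in>ch V D h. if y = z then ?a y else 0) = ?a z" for z
    using zero[of z] finite_ch by simp
  have "?c = (\<Sum>y\<in>ch V D h. (\<lambda>i. ?a y * sym_unit {v, y} i))"
  proof (rule ext, clarify)
    fix u w
    have "(\<Sum>y\<in>ch V D h. ?a y * sym_unit {v, y} (u, w)) =
        (if u = v then ?a w else if w = v then ?a u else 0)"
    proof -
      have "?a y * sym_unit {v, y} (u, w) =
          (if u = v then if y = w then ?a y else 0
           else if w = v then if y = u then ?a y else 0 else 0)" for y
        by (auto simp: sym_unit_def doubleton_eq_iff)
      then show ?thesis using pick by simp
    qed
    \<comment> \<open>This matches the cut-off of \<open>?c\<close> outside
      \<open>V \<times> V\<close>: the coefficients vanish there as well.\<close>
    moreover have "\<Lambda> y h = 0" if "y \<notin> V" for y using that zero chV by blast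
    ultimately show "?c (u, w) = (\<Sum>y\<in>ch V D h. (\<lambda>i. ?a y * sym_unit {v, y} i)) (u, w)"
      using v unfolding sum_apply
      by (auto simp: tau_jacobian_loading[OF finite_latent h] simp del: tau_jacobian.simps)
  qed
  then show ?thesis
    by (simp only:) (intro f.span_sum f.span_scale f.span_base imageI)
qed

text \<open>The collection may depend on the parameter, since it is read off from a basis of the
  column space at that point.\<close>

lemma jacobian_rank_le_valid_collection:
  assumes \<Lambda>: "(\<omega>, \<Lambda>) \<in> parameter_space V D"
  shows "\<exists>B. valid_collection V H D B \<and>
    matrix_rank (V \<times> V) (parameter_indices V D) (tau_jacobian H \<omega> \<Lambda>)
      \<le> card V + (\<Sum>h\<in>H. card (B h))"
proof -
  interpret f: vector_space "\<lambda>(c::real) (f :: 'a \<times> 'a \<Rightarrow> real) x. c * f x"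
    by (rule vector_space_fun)
  define col where "col = (\<lambda>j i. if i \<in> V \<times> V then tau_jacobian H \<omega> \<Lambda> i j else 0)"
  define U :: "('a \<times> 'a \<Rightarrow> real) set" where "U = (\<lambda>v. sym_unit {v}) ` V"
  have diag: "col (Inl v) = sym_unit {v}" if "v \<in> V" for v
    using that
    by (auto simp: col_def fun_eq_iff tau_jacobian_diagonal sym_unit_def simp del: tau_jacobian.simps)
  have cols: "col ` parameter_indices V D = U \<union> (col \<circ> Inr) ` D"
    using diag by (force simp: parameter_indices_def U_def image_Un image_image Plus_def)
  \<comment> \<open>A basis \<open>T\<close> of the span of the diagonal columns is extended to a
    basis \<open>B\<close> of the column space. The rank becomes \<open>card T + card S\<close>,
    with \<open>card T\<close> at most \<open>card V\<close>, so only \<open>S\<close> has to be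
    turned into pairs.\<close>
  obtain T where T: "T \<subseteq> U" "f.independent T" "U \<subseteq> f.span T"
    by (rule f.maximal_independent_subset)
  obtain B where B: "T \<subseteq> B" "B \<subseteq> U \<union> (col \<circ> Inr) ` D" "f.independent B"
      "U \<union> (col \<circ> Inr) ` D \<subseteq> f.span B"
    using f.maximal_independent_subset_extend[of T "U \<union> (col \<circ> Inr) ` D"] T by blast
  define S where "S = B - T"
  have finU: "finite U" using finite_observed by (simp add: U_def)
  have finB: "finite B"
    using B(2) finU finite_edges by (auto intro: finite_subset)
  \<comment> \<open>Elements of \<open>U\<close> lie in \<open>span T\<close>, so such an
    \<open>x\<close> would depend on the rest of \<open>B\<close>.\<close>
  have S_notU: "x \<notin> U" if "x \<in> S" for x
  proof
    assume "x \<in> U"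
    then have "x \<in> f.span (B - {x})"
      using T(3) f.span_mono[of T "B - {x}"] that B(1) by (auto simp: S_def)
    then show False using B(3) that by (auto simp: S_def f.dependent_def)
  qed
  then have "\<forall>x\<in>S. \<exists>d\<in>D. x = col (Inr d)"
    using B(2) by (auto simp: S_def)
  \<comment> \<open>Different edges may have equal columns, so one edge is chosen per column. The
    edge determines the column, hence \<open>k\<close> is injective.\<close>
  then obtain k where k: "\<And>x. x \<in> S \<Longrightarrow> k x \<in> D \<and> x = col (Inr (k x))"
    by metis
  have injk: "inj_on k S" by (metis inj_onI k)
  define N where "N x = (\<lambda>y. sym_unit {snd (k x), y}) ` ch V D (fst (k x))" for x
  have "x \<in> f.span (N x)" if "x \<in> S" for x
    using tau_jacobian_loading_in_span[OF _ \<Lambda>, of "fst (k x)" "snd (k x)"] k[OF that]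
    unfolding N_def col_def prod.collapse by metis
  moreover have "S \<union> T = B" using B(1) by (auto simp: S_def)
  ultimately obtain \<phi> where \<phi>: "inj_on \<phi> S" "\<forall>x\<in>S. \<phi> x \<in> N x - f.span T"
    using f.independent_imp_matching[of S T N] B(3) finB by (auto simp: S_def)
  have "\<exists>p \<in> two_pairs_at V H D (fst (k x)). \<phi> x = sym_unit p" if x: "x \<in> S" for x
  proof -
    obtain h v where hv: "k x = (h, v)" by force
    have D: "(h, v) \<in> D" "h \<in> H" "v \<in> V" using k[OF x] hv edges_latent_to_observed by auto
    obtain y where y: "y \<in> ch V D h" "\<phi> x = sym_unit {v, y}"
      using \<phi>(2) x by (auto simp: N_def hv)
    have "sym_unit {v} \<in> f.span T"
      using T(3) D by (auto simp: U_def)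
    \<comment> \<open>This is why the matching has to avoid \<open>span T\<close>: the diagonal unit
      is excluded, and \<open>{v, y}\<close> is a genuine pair.\<close>
    then have "y \<noteq> v"
      using \<phi>(2) x y(2) by auto
    then have "{v, y} \<in> two_pairs_at V H D h"
      using y D by (auto simp: two_pairs_at_def two_pairs_def pa_def ch_def)
    then show ?thesis using y(2) hv by auto
  qed
  then obtain g where g: "\<And>x. x \<in> S \<Longrightarrow> g x \<in> two_pairs_at V H D (fst (k x)) \<and> \<phi> x = sym_unit (g x)"
    by metis
  have injg: "inj_on g S" by (metis inj_on_def \<phi>(1) g)
  \<comment> \<open>\<open>S\<close> is grouped by the latent node of the chosen edge. Injectivity
    of \<open>g\<close> makes the images of different groups disjoint.\<close>
  define F where "F h = {x \<in> S. fst (k x) = h}" for h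
  have finS: "finite S" using finB by (simp add: S_def)
  have cardF: "card (g ` F h) = card (F h)" for h
    by (intro card_image inj_on_subset[OF injg]) (auto simp: F_def)
  have "valid_collection V H D (\<lambda>h. g ` F h)"
    unfolding valid_collection_def
  proof (intro conjI ballI impI)
    fix h
    show "g ` F h \<subseteq> two_pairs_at V H D h" using g by (auto simp: F_def)
    \<comment> \<open>Edges chosen in \<open>F h\<close> share the source \<open>h\<close>, so they
      are told apart by their targets, which are children of \<open>h\<close>.\<close>
    have "inj_on (snd \<circ> k) (F h)"
      using injk by (auto simp: F_def inj_on_def prod_eq_iff)
    moreover have "(snd \<circ> k) ` F h \<subseteq> ch V D h"
      using k edges_latent_to_observed by (fastforce simp: F_def ch_def)
    ultimately show "card (g ` F h) \<le> card (ch V D h)"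
      unfolding cardF using finite_ch by (rule card_inj_on_le)
  next
    fix h l :: 'a assume "h \<noteq> l"
    then show "g ` F h \<inter> g ` F l = {}"
      using injg by (auto simp: F_def inj_on_def)
  qed
  moreover have "card S = (\<Sum>h\<in>H. card (g ` F h))"
  proof -
    have "S = (\<Union>h\<in>H. F h)"
      using k edges_latent_to_observed by (fastforce simp: F_def)
    then have "card S = card (\<Union>h\<in>H. F h)" by simp
    also have "\<dots> = (\<Sum>h\<in>H. card (F h))"
      using finite_latent finS by (intro card_UN_disjoint) (auto simp: F_def)
    finally show ?thesis by (simp add: cardF)
  qed
  moreover have "matrix_rank (V \<times> V) (parameter_indices V D) (tau_jacobian H \<omega> \<Lambda>) = card B"
    using f.dim_unique[OF B(2,4,3) refl] unfolding matrix_rank_def col_def[symmetric] cols .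
  moreover have "card B = card T + card S"
    using card_Un_disjoint[of T S] finB B(1) finS
    by (metis Diff_disjoint Diff_partition S_def finite_subset)
  moreover have "card T \<le> card V"
    using card_mono[OF finU T(1)] card_image_le[OF finite_observed, of "\<lambda>v. sym_unit {v}"]
    by (simp add: U_def)
  ultimately show ?thesis by auto
qed

end

theorem theorem2p9:
  fixes V H :: "'a set" and D :: "('a \<times> 'a) set" and A :: "'a \<Rightarrow> 'a set set"
  assumes "factor_analysis_graph V H D"
    and "valid_collection V H D A"
    and "\<And>B. valid_collection V H D B \<Longrightarrow> (\<Sum>h\<in>H. card (B h)) \<le> (\<Sum>h\<in>H. card (A h))"
  shows "dim_factor_analysis_model V H D \<le> card V + (\<Sum>h\<in>H. card (A h))"
proof -
  interpret factor_analysis_graph V H D by fact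
  \<comment> \<open>Maximality of \<open>A\<close> replaces the parameter-dependent collections by
    one bound valid for the maximum over all parameters.\<close>
  have "matrix_rank (V \<times> V) (parameter_indices V D) (tau_jacobian H \<omega> \<Lambda>)
      \<le> card V + (\<Sum>h\<in>H. card (A h))" if "(\<omega>, \<Lambda>) \<in> parameter_space V D" for \<omega> \<Lambda>
    using jacobian_rank_le_valid_collection[OF that] assms(3)
    by (meson add_left_mono order_trans)
  then show ?thesis
    unfolding dim_factor_analysis_model_def
    using jacobian_ranks_finite parameter_space_nonempty by (subst Max_le_iff) auto
qed

end
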